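(* Let $t\ge 2$ and let $a\ge d\ge 0$ be integers with $a\ge 1$. Then ${\rm forb}(m,t\cdot F_{a,0,0,d})$ is $\Theta(m^a)$ as $m\to\infty$.
   Context: A matrix is simple if it is a (0,1)-matrix with no repeated columns. For (0,1)-matrices $F$ and $A$, $F\prec A$ means some row and column permutation of $F$ is a submatrix of $A$. ${\rm forb}(m,F)$ is the maximum number of columns of an $m$-rowed simple matrix $A$ with $F\not\prec A$ ($F$ need not be simple). $t\cdot M$ denotes the concatenation of $t$ copies of the matrix $M$. $F_{e,f,g,h}$ denotes the $(e+f+g+h)\times 2$ (0,1)-matrix with $e$ rows $[1\,1]$, $f$ rows $[1\,0]$, $g$ rows $[0\,1]$ and $h$ rows $[0\,0]$. *)

theory Defs
  imports
    "Jordan_Normal_Form.DL_Submatrix"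
    "HOL-Combinatorics.Permutations"
    "HOL-Library.Landau_Symbols"
begin

definition zero_one_mat :: "nat mat \<Rightarrow> bool" where
  "zero_one_mat A \<longleftrightarrow> elements_mat A \<subseteq> {0, 1}"

definition simple_mat :: "nat mat \<Rightarrow> bool" where
  "simple_mat A \<longleftrightarrow> zero_one_mat A \<and> distinct (cols A)"

definition permute_mat :: "(nat \<Rightarrow> nat) \<Rightarrow> (nat \<Rightarrow> nat) \<Rightarrow> 'a mat \<Rightarrow> 'a mat" where
  "permute_mat p q F = mat (dim_row F) (dim_col F) (\<lambda>(i, j). F $$ (p i, q j))"

definition configuration_in :: "'a mat \<Rightarrow> 'a mat \<Rightarrow> bool" (infix "\<prec>\<^sub>c" 50) where
  "F \<prec>\<^sub>c A \<longleftrightarrow>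
     (\<exists>p q I J. p permutes {..<dim_row F} \<and> q permutes {..<dim_col F} \<and>
        permute_mat p q F = submatrix A I J)"

definition avoiding :: "nat \<Rightarrow> nat mat \<Rightarrow> nat mat set" where
  "avoiding m F = {A. dim_row A = m \<and> simple_mat A \<and> \<not> F \<prec>\<^sub>c A}"

definition forb :: "nat \<Rightarrow> nat mat \<Rightarrow> nat" where
  "forb m F = Max (dim_col ` avoiding m F)"

definition copies_mat :: "nat \<Rightarrow> 'a mat \<Rightarrow> 'a mat" where
  "copies_mat t M = mat_of_cols (dim_row M) (concat (replicate t (cols M)))"

definition F_mat :: "nat \<Rightarrow> nat \<Rightarrow> nat \<Rightarrow> nat \<Rightarrow> nat mat" where
  "F_mat e f g h = mat_of_rows_list 2
     (replicate e [1, 1] @ replicate f [1, 0] @ replicate g [0, 1] @ replicate h [0, 0])"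

text \<open>The maximum in \<^const>\<open>forb\<close> is attained: the set is finite, and nonempty as soon as
  the forbidden matrix has a column.\<close>

lemma finite_dim_col_avoiding: "finite (dim_col ` avoiding m F)"
proof -
  define V where "V = {v :: nat vec. dim_vec v = m \<and> (\<forall>i<m. v $ i \<in> {0, 1})}"
  have "V \<subseteq> vec_of_list ` {xs. set xs \<subseteq> {0, 1} \<and> length xs = m}"
  proof
    fix v assume v: "v \<in> V"
    have "set (list_of_vec v) \<subseteq> {0, 1}"
    proof
      fix x assume "x \<in> set (list_of_vec v)"
      then obtain i where i: "i < m" "x = list_of_vec v ! i"
        using v unfolding V_def by (auto simp: in_set_conv_nth)
      then have "x = v $ i"
        by (metis list_of_vec_index)
      moreover have "v $ i \<in> {0, 1}" using v i(1) unfolding V_def by simp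
      ultimately show "x \<in> {0, 1}" by simp
    qed
    moreover have "length (list_of_vec v) = m" using v unfolding V_def by simp
    ultimately show "v \<in> vec_of_list ` {xs. set xs \<subseteq> {0, 1} \<and> length xs = m}"
      by (intro image_eqI[where x = "list_of_vec v"]) (simp_all add: vec_list)
  qed
  then have fin: "finite V"
    by (rule finite_subset) (intro finite_imageI finite_lists_length_eq, simp)
  have "dim_col A \<le> card V" if "A \<in> avoiding m F" for A
  proof -
    have A: "dim_row A = m" "zero_one_mat A" "distinct (cols A)"
      using that unfolding avoiding_def simple_mat_def by auto
    have "set (cols A) \<subseteq> V"
    proof
      fix v assume "v \<in> set (cols A)"
      then obtain j where j: "j < dim_col A" "v = col A j"
        by (auto simp: cols_def)
      have "v $ i \<in> {0, 1}" if "i < m" for i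
      proof -
        have "A \<in> carrier_mat m (dim_col A)"
          by (rule carrier_matI[OF A(1) refl])
        then have "A $$ (i, j) \<in> elements_mat A"
          by (rule elements_matI[OF _ that j(1) refl])
        then have "A $$ (i, j) \<in> {0, 1}"
          by (rule subsetD[OF A(2)[unfolded zero_one_mat_def]])
        moreover have "v $ i = A $$ (i, j)"
          unfolding j(2) by (rule index_col) (use that A(1) j(1) in simp_all)
        ultimately show ?thesis by (simp only:)
      qed
      then show "v \<in> V" unfolding V_def using A(1) j(2) by simp
    qed
    then have "card (set (cols A)) \<le> card V" by (rule card_mono[OF fin])
    then show ?thesis using A by (simp add: distinct_card)
  qed
  then have "dim_col ` avoiding m F \<subseteq> {..card V}" by auto
  then show ?thesis by (rule finite_subset) simp
qed

lemma avoiding_nonempty: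
  assumes "dim_col F > 0"
  shows "avoiding m F \<noteq> {}"
proof -
  have "\<not> F \<prec>\<^sub>c 0\<^sub>m m 0"
  proof
    assume "F \<prec>\<^sub>c 0\<^sub>m m 0"
    then obtain p q I J where "permute_mat p q F = submatrix (0\<^sub>m m 0) I J"
      unfolding configuration_in_def by blast
    then have "dim_col (permute_mat p q F) = dim_col (submatrix (0\<^sub>m m 0 :: nat mat) I J)"
      by simp
    then show False using assms by (simp add: permute_mat_def dim_submatrix)
  qed
  moreover have "simple_mat (0\<^sub>m m 0)"
    by (auto simp: simple_mat_def zero_one_mat_def elements_mat_def cols_def)
  ultimately have "0\<^sub>m m 0 \<in> avoiding m F" unfolding avoiding_def by simp
  then show ?thesis by blast
qed

end

theory Submission
  imports Defs "HOL-Real_Asymp.Real_Asymp"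
begin

text \<open>
  The matrix \<open>t \<cdot> F\<^bsub>a,0,0,d\<^esub>\<close> consists of \<open>2t\<close> copies of one column with \<open>a\<close> ones and \<open>d\<close> zeros.
  Read columns as subsets of the row set: a configuration is then a pair of disjoint sets
  \<open>R\<close>, \<open>S\<close> of sizes \<open>a\<close>, \<open>d\<close> together with \<open>2t\<close> members of the family that contain \<open>R\<close> and
  avoid \<open>S\<close>.

  For the lower bound take all \<open>a\<close>-element sets. For the upper bound put \<open>k = min a d\<close> and generalise
  the hypothesis: if no pair of sizes \<open>(x, y)\<close> with \<open>x \<le> a\<close>, \<open>y \<le> d\<close>, \<open>x + y = k + e\<close> occurs, then
  the family has \<open>O(m\<^sup>e)\<close> members. Deleting a row \<open>v\<close> merges exactly the pairs \<open>B\<close>, \<open>B \<union> {v}\<close>; the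
  sets \<open>B\<close> that are doubled in this way satisfy the hypothesis for \<open>e - 1\<close>, because \<open>v\<close> can be
  appended both to \<open>R\<close> and to \<open>S\<close>. For \<open>e = 0\<close> every pattern on \<open>k\<close> rows is forbidden, and the
  pigeonhole principle on any \<open>k\<close> rows bounds the family by a constant. The case \<open>e = max a d\<close> is
  the original hypothesis.
\<close>

subsection \<open>Set families without a pattern\<close>

definition cylinder :: "'a set \<Rightarrow> 'a set \<Rightarrow> 'a set set \<Rightarrow> 'a set set" where
  "cylinder R S \<A> = {B \<in> \<A>. R \<subseteq> B \<and> S \<inter> B = {}}"

definition has_pattern :: "'a set \<Rightarrow> nat \<Rightarrow> nat \<Rightarrow> nat \<Rightarrow> 'a set set \<Rightarrow> bool" where
  "has_pattern V s a d \<A> \<longleftrightarrow>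
     (\<exists>R S. R \<subseteq> V \<and> S \<subseteq> V \<and> R \<inter> S = {} \<and> card R = a \<and> card S = d \<and> s \<le> card (cylinder R S \<A>))"

definition pattern_free :: "'a set \<Rightarrow> nat \<Rightarrow> nat \<Rightarrow> nat \<Rightarrow> nat \<Rightarrow> 'a set set \<Rightarrow> bool" where
  "pattern_free V s a d n \<A> \<longleftrightarrow>
     (\<forall>x y. x \<le> a \<longrightarrow> y \<le> d \<longrightarrow> x + y = n \<longrightarrow> \<not> has_pattern V s x y \<A>)"

definition deletion :: "'a \<Rightarrow> 'a set set \<Rightarrow> 'a set set" where
  "deletion v \<A> = (\<lambda>B. B - {v}) ` \<A>"

definition doubled :: "'a \<Rightarrow> 'a set set \<Rightarrow> 'a set set" where
  "doubled v \<A> = {B \<in> \<A>. v \<notin> B \<and> insert v B \<in> \<A>}"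

lemma finite_cylinder: "finite \<A> \<Longrightarrow> finite (cylinder R S \<A>)"
  by (simp add: cylinder_def)

lemma has_patternI:
  assumes "R \<subseteq> V" "S \<subseteq> V" "R \<inter> S = {}" "card R = a" "card S = d" "s \<le> card (cylinder R S \<A>)"
  shows "has_pattern V s a d \<A>"
  unfolding has_pattern_def using assms by blast

lemma has_patternE:
  assumes "has_pattern V s a d \<A>"
  obtains R S where "R \<subseteq> V" "S \<subseteq> V" "R \<inter> S = {}" "card R = a" "card S = d"
    "s \<le> card (cylinder R S \<A>)"
  using assms unfolding has_pattern_def by blast

lemma deletion_subset_Pow: "\<A> \<subseteq> Pow (insert v V) \<Longrightarrow> deletion v \<A> \<subseteq> Pow V"
  by (auto simp: deletion_def)

lemma doubled_subset_Pow: "\<A> \<subseteq> Pow (insert v V) \<Longrightarrow> doubled v \<A> \<subseteq> Pow V"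
  by (auto simp: doubled_def)

lemma card_eq_deletion_plus_doubled:
  assumes "finite \<A>"
  shows "card \<A> = card (deletion v \<A>) + card (doubled v \<A>)"
proof -
  define without containing where "without = {B \<in> \<A>. v \<notin> B}" and "containing = {B \<in> \<A>. v \<in> B}"
  have split: "\<A> = without \<union> containing"
    by (auto simp: without_def containing_def)
  have fin: "finite without" "finite containing"
    using assms by (auto simp: without_def containing_def)
  have "deletion v without = without"
    by (auto simp: deletion_def without_def image_iff)
  then have union: "deletion v \<A> = without \<union> deletion v containing"
    unfolding split by (simp add: deletion_def image_Un)
  have "B \<in> deletion v containing \<longleftrightarrow> insert v B \<in> \<A>" if "v \<notin> B" for B
  proof
    assume "insert v B \<in> \<A>"
    then have "insert v B \<in> containing" "B = insert v B - {v}"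
      using that by (auto simp: containing_def)
    then show "B \<in> deletion v containing"
      unfolding deletion_def by (rule rev_image_eqI)
  qed (auto simp: deletion_def containing_def insert_absorb)
  then have inter: "doubled v \<A> = without \<inter> deletion v containing"
    by (auto simp: doubled_def without_def)
  have "card \<A> = card without + card containing"
    unfolding split using fin by (intro card_Un_disjoint) (auto simp: without_def containing_def)
  also have "card containing = card (deletion v containing)"
    unfolding deletion_def by (subst card_image) (auto simp: containing_def inj_on_def)
  also have "card without + \<dots> = card (deletion v \<A>) + card (doubled v \<A>)"
    unfolding union inter using fin by (intro card_Un_Int) (simp_all add: deletion_def)
  finally show ?thesis .
qed

lemma card_cylinder_deletion_le:
  assumes "finite \<A>" "v \<notin> R" "v \<notin> S"
  shows "card (cylinder R S (deletion v \<A>)) \<le> card (cylinder R S \<A>)"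
proof -
  have "cylinder R S (deletion v \<A>) = deletion v (cylinder R S \<A>)"
    using assms(2,3) by (auto simp: cylinder_def deletion_def)
  then show ?thesis
    using assms(1) by (simp add: deletion_def card_image_le finite_cylinder)
qed

lemma card_cylinder_doubled_le_insert_right:
  assumes "finite \<A>"
  shows "card (cylinder R S (doubled v \<A>)) \<le> card (cylinder R (insert v S) \<A>)"
  using assms by (intro card_mono finite_cylinder) (auto simp: cylinder_def doubled_def)

lemma card_cylinder_doubled_le_insert_left:
  assumes "finite \<A>" "v \<notin> S"
  shows "card (cylinder R S (doubled v \<A>)) \<le> card (cylinder (insert v R) S \<A>)"
proof (rule card_inj_on_le)
  show "inj_on (insert v) (cylinder R S (doubled v \<A>))"
    by (auto simp: inj_on_def cylinder_def doubled_def insert_ident)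
  show "insert v ` cylinder R S (doubled v \<A>) \<subseteq> cylinder (insert v R) S \<A>"
    using assms(2) by (auto simp: cylinder_def doubled_def)
qed (rule finite_cylinder[OF assms(1)])

lemma has_pattern_deletion:
  assumes "finite \<A>" "v \<notin> V" "has_pattern V s a d (deletion v \<A>)"
  shows "has_pattern (insert v V) s a d \<A>"
  using assms(3)
proof (rule has_patternE)
  fix R S assume RS: "R \<subseteq> V" "S \<subseteq> V" "R \<inter> S = {}" "card R = a" "card S = d"
    and "s \<le> card (cylinder R S (deletion v \<A>))"
  moreover have "card (cylinder R S (deletion v \<A>)) \<le> card (cylinder R S \<A>)"
    using assms RS by (intro card_cylinder_deletion_le) auto
  ultimately show ?thesis
    by (intro has_patternI[of R _ S]) auto
qed

lemma has_pattern_doubled: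
  assumes "finite \<A>" "finite V" "v \<notin> V" "has_pattern V s a d (doubled v \<A>)"
  shows "has_pattern (insert v V) s (Suc a) d \<A>" and "has_pattern (insert v V) s a (Suc d) \<A>"
proof -
  obtain R S where RS: "R \<subseteq> V" "S \<subseteq> V" "R \<inter> S = {}" "card R = a" "card S = d"
    and large: "s \<le> card (cylinder R S (doubled v \<A>))"
    using assms(4) by (rule has_patternE)
  have v: "v \<notin> R" "v \<notin> S"
    using RS assms(3) by auto
  have fin: "finite R" "finite S"
    using RS assms(2) by (auto intro: finite_subset)
  show "has_pattern (insert v V) s (Suc a) d \<A>"
  proof (rule has_patternI[of "insert v R" _ S])
    show "s \<le> card (cylinder (insert v R) S \<A>)"
      using large card_cylinder_doubled_le_insert_left[OF assms(1) v(2)] by (rule order.trans)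
  qed (use RS v fin in auto)
  show "has_pattern (insert v V) s a (Suc d) \<A>"
  proof (rule has_patternI[of R _ "insert v S"])
    show "s \<le> card (cylinder R (insert v S) \<A>)"
      using large card_cylinder_doubled_le_insert_right[OF assms(1)] by (rule order.trans)
  qed (use RS v fin in auto)
qed

lemma pattern_free_deletion:
  assumes "finite \<A>" "v \<notin> V" "pattern_free (insert v V) s a d n \<A>"
  shows "pattern_free V s a d n (deletion v \<A>)"
  using assms(3) has_pattern_deletion[OF assms(1,2)] unfolding pattern_free_def by metis

lemma pattern_free_doubled:
  assumes "finite \<A>" "finite V" "v \<notin> V" "n < a + d" "pattern_free (insert v V) s a d (Suc n) \<A>"
  shows "pattern_free V s a d n (doubled v \<A>)"
  unfolding pattern_free_def
proof (intro allI impI notI)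
  fix x y assume xy: "x \<le> a" "y \<le> d" "x + y = n"
    and pattern: "has_pattern V s x y (doubled v \<A>)"
  consider "x < a" | "y < d"
    using xy assms(4) by linarith
  then show False
  proof cases
    assume "x < a"
    then show False
      using xy assms(5) has_pattern_doubled(1)[OF assms(1-3) pattern]
      by (auto simp: pattern_free_def)
  next
    assume "y < d"
    then show False
      using xy assms(5) has_pattern_doubled(2)[OF assms(1-3) pattern]
      by (auto simp: pattern_free_def)
  qed
qed

lemma card_le_sum_cylinder:
  assumes "finite \<A>" "finite D"
  shows "card \<A> \<le> (\<Sum>R\<in>Pow D. card (cylinder R (D - R) \<A>))"
proof -
  have "B \<in> cylinder (B \<inter> D) (D - B \<inter> D) \<A>" if "B \<in> \<A>" for B
    using that by (auto simp: cylinder_def)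
  then have "\<A> \<subseteq> (\<Union>R\<in>Pow D. cylinder R (D - R) \<A>)"
    by blast
  then have "card \<A> \<le> card (\<Union>R\<in>Pow D. cylinder R (D - R) \<A>)"
    using assms by (intro card_mono) (auto intro: finite_cylinder)
  also have "\<dots> \<le> (\<Sum>R\<in>Pow D. card (cylinder R (D - R) \<A>))"
    using assms(2) by (intro card_UN_le) simp
  finally show ?thesis .
qed

lemma card_le_if_pattern_free_const:
  assumes "finite V" "\<A> \<subseteq> Pow V" "s \<ge> 1" "k \<le> a" "k \<le> d" "pattern_free V s a d k \<A>"
  shows "card \<A> \<le> 2 ^ k * s"
proof (cases "card V < k")
  case True
  have "card \<A> \<le> card (Pow V)"
    using assms(1,2) by (intro card_mono) auto
  also have "\<dots> \<le> 2 ^ k"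
    using True assms(1) by (simp add: card_Pow)
  also have "\<dots> \<le> 2 ^ k * s"
    using assms(3) by simp
  finally show ?thesis .
next
  case False
  then obtain D where D: "D \<subseteq> V" "card D = k" "finite D"
    by (metis not_less obtain_subset_with_card_n)
  have "finite \<A>"
    using assms(1,2) by (meson finite_Pow_iff finite_subset)
  then have "card \<A> \<le> (\<Sum>R\<in>Pow D. card (cylinder R (D - R) \<A>))"
    using D(3) by (rule card_le_sum_cylinder)
  also have "\<dots> \<le> (\<Sum>R\<in>Pow D. s)"
  proof (rule sum_mono)
    fix R assume R: "R \<in> Pow D"
    then have sizes: "card R + card (D - R) = k"
      using D by (metis PowD card_Diff_subset card_mono finite_subset le_add_diff_inverse)
    show "card (cylinder R (D - R) \<A>) \<le> s"
    proof (rule ccontr)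
      assume "\<not> ?thesis"
      then have "has_pattern V s (card R) (card (D - R)) \<A>"
        using R D(1) by (intro has_patternI[of R _ "D - R"]) auto
      then show False
        using assms(4-6) sizes by (auto simp: pattern_free_def)
    qed
  qed
  also have "\<dots> = 2 ^ k * s"
    using D by (simp add: card_Pow)
  finally show ?thesis .
qed

lemma card_le_if_pattern_free:
  assumes "finite V" "\<A> \<subseteq> Pow V" "s \<ge> 1" "k \<le> a" "k \<le> d" "k + e \<le> a + d"
    and "pattern_free V s a d (k + e) \<A>"
  shows "card \<A> \<le> 2 ^ k * s * (card V + 1) ^ e"
  using assms(1,2,6,7)
proof (induction V arbitrary: \<A> e rule: finite_induct)
  case empty
  then have "card \<A> \<le> card (Pow {} :: 'a set set)"
    by (intro card_mono) auto
  also have "\<dots> \<le> 2 ^ k * s * (card ({} :: 'a set) + 1) ^ e"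
    using assms(3) by simp
  finally show ?case .
next
  case (insert v V)
  let ?C = "2 ^ k * s" and ?n = "card V + 1"
  have fin: "finite \<A>"
    using insert.prems(1) insert.hyps(1) by (meson finite_Pow_iff finite_insert finite_subset)
  show ?case
  proof (cases e)
    case 0
    then show ?thesis
      using card_le_if_pattern_free_const[OF _ insert.prems(1) assms(3-5)] insert.hyps(1)
        insert.prems(3) by simp
  next
    case (Suc f)
    have deletion: "card (deletion v \<A>) \<le> ?C * ?n ^ Suc f"
      using Suc insert.hyps(2) insert.prems fin
      by (intro insert.IH pattern_free_deletion deletion_subset_Pow) auto
    have doubled: "card (doubled v \<A>) \<le> ?C * ?n ^ f"
      using Suc insert.hyps insert.prems fin
      by (intro insert.IH pattern_free_doubled doubled_subset_Pow) auto
    have "card \<A> \<le> ?C * ?n ^ Suc f + ?C * ?n ^ f"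
      using deletion doubled unfolding card_eq_deletion_plus_doubled[OF fin, of v] by (rule add_mono)
    also have "\<dots> = ?C * ((?n + 1) * ?n ^ f)"
      by (simp add: algebra_simps)
    also have "\<dots> \<le> ?C * ((?n + 1) * (?n + 1) ^ f)"
      by (intro mult_left_mono power_mono) auto
    finally show ?thesis
      using Suc insert.hyps by simp
  qed
qed

lemma not_has_pattern_uniform:
  assumes "finite V" "s \<ge> 2"
  shows "\<not> has_pattern V s a d {B. B \<subseteq> V \<and> card B = a}"
proof
  let ?\<A> = "{B. B \<subseteq> V \<and> card B = a}"
  assume "has_pattern V s a d ?\<A>"
  then obtain R S where R: "card R = a" and large: "s \<le> card (cylinder R S ?\<A>)"
    by (rule has_patternE)
  have "B = R" if "B \<in> cylinder R S ?\<A>" for B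
  proof -
    have "finite B" "R \<subseteq> B" "card R = card B"
      using that R assms(1) by (auto simp: cylinder_def intro: finite_subset)
    then show "B = R"
      using card_subset_eq by metis
  qed
  then have "card (cylinder R S ?\<A>) \<le> card {R}"
    by (intro card_mono) auto
  then show False
    using large assms(2) by simp
qed

subsection \<open>Configurations as embeddings\<close>

lemma bij_betw_pick:
  assumes "finite I"
  shows "bij_betw (pick I) {..<card I} I"
proof -
  have inj: "inj_on (pick I) {..<card I}"
    by (rule linorder_inj_onI) (auto dest: pick_mono_le)
  moreover have "pick I ` {..<card I} = I"
  proof (rule card_subset_eq[OF assms])
    show "pick I ` {..<card I} \<subseteq> I"
      using pick_in_set_le by blast
  qed (use inj in \<open>simp add: card_image\<close>)
  ultimately show ?thesis
    by (simp add: bij_betw_def)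
qed

lemma bij_betw_pick_bounded:
  "bij_betw (pick I) {..<card {i. i < n \<and> i \<in> I}} {i. i < n \<and> i \<in> I}"
proof -
  let ?I = "{i. i < n \<and> i \<in> I}"
  have "bij_betw (pick ?I) {..<card ?I} ?I"
    by (rule bij_betw_pick) simp
  then show ?thesis
    using bij_betw_cong[of "{..<card ?I}" "pick I" "pick ?I" ?I] pick_reduce_set by simp
qed

lemma ex_permutes_pick_image:
  assumes "inj_on f {..<n}"
  obtains p where "p permutes {..<n}" "\<And>i. i < n \<Longrightarrow> f (p i) = pick (f ` {..<n}) i"
proof -
  let ?I = "f ` {..<n}"
  define p where "p i = (if i < n then inv_into {..<n} f (pick ?I i) else i)" for i
  have pick: "bij_betw (pick ?I) {..<n} ?I"
    using bij_betw_pick[of ?I] assms by (simp add: card_image)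
  moreover have "bij_betw (inv_into {..<n} f) ?I {..<n}"
    using assms by (intro bij_betw_inv_into) (simp add: bij_betw_def)
  ultimately have "bij_betw (inv_into {..<n} f \<circ> pick ?I) {..<n} {..<n}"
    by (rule bij_betw_trans)
  then have "bij_betw p {..<n} {..<n}"
    by (rule bij_betw_cong[THEN iffD1, rotated]) (simp add: p_def)
  then have "p permutes {..<n}"
    by (rule bij_imp_permutes) (simp add: p_def)
  moreover have "f (p i) = pick ?I i" if "i < n" for i
  proof -
    have "pick ?I i \<in> ?I"
      using pick that by (auto simp: bij_betw_def)
    then show ?thesis
      using that by (simp add: p_def f_inv_into_f)
  qed
  ultimately show thesis
    using that by blast
qed

definition embeds_via :: "(nat \<Rightarrow> nat) \<Rightarrow> (nat \<Rightarrow> nat) \<Rightarrow> 'a mat \<Rightarrow> 'a mat \<Rightarrow> bool" where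
  "embeds_via f g F A \<longleftrightarrow>
     inj_on f {..<dim_row F} \<and> f ` {..<dim_row F} \<subseteq> {..<dim_row A} \<and>
     inj_on g {..<dim_col F} \<and> g ` {..<dim_col F} \<subseteq> {..<dim_col A} \<and>
     (\<forall>i<dim_row F. \<forall>j<dim_col F. F $$ (i, j) = A $$ (f i, g j))"

lemma embeds_via_if_configuration_in:
  assumes "F \<prec>\<^sub>c A"
  shows "\<exists>f g. embeds_via f g F A"
proof -
  obtain p q I J where p: "p permutes {..<dim_row F}" and q: "q permutes {..<dim_col F}"
    and eq: "permute_mat p q F = submatrix A I J"
    using assms unfolding configuration_in_def by blast
  let ?I = "{i. i < dim_row A \<and> i \<in> I}" and ?J = "{j. j < dim_col A \<and> j \<in> J}"
  let ?f = "pick I \<circ> inv_into UNIV p" and ?g = "pick J \<circ> inv_into UNIV q"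
  have dims: "card ?I = dim_row F" "card ?J = dim_col F"
    using arg_cong[OF eq, of dim_row] arg_cong[OF eq, of dim_col]
    by (simp_all add: permute_mat_def dim_submatrix)
  have "bij_betw (inv_into UNIV p) {..<dim_row F} {..<dim_row F}"
    "bij_betw (inv_into UNIV q) {..<dim_col F} {..<dim_col F}"
    using p q by (simp_all add: permutes_inv permutes_imp_bij)
  then have "bij_betw ?f {..<dim_row F} ?I" "bij_betw ?g {..<dim_col F} ?J"
    using bij_betw_pick_bounded[of I "dim_row A"] bij_betw_pick_bounded[of J "dim_col A"]
    unfolding dims by (blast intro: bij_betw_trans)+
  moreover have "F $$ (i, j) = A $$ (?f i, ?g j)" if "i < dim_row F" "j < dim_col F" for i j
  proof -
    have bounds: "inv_into UNIV p i < dim_row F" "inv_into UNIV q j < dim_col F"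
      using that permutes_in_image[OF permutes_inv[OF p]] permutes_in_image[OF permutes_inv[OF q]]
      by (metis lessThan_iff)+
    then have "F $$ (i, j) = permute_mat p q F $$ (inv_into UNIV p i, inv_into UNIV q j)"
      using permutes_inverses(1)[OF p] permutes_inverses(1)[OF q] by (simp add: permute_mat_def)
    also have "\<dots> = A $$ (?f i, ?g j)"
      unfolding eq using bounds dims by (simp add: submatrix_index)
    finally show ?thesis .
  qed
  ultimately have "embeds_via ?f ?g F A"
    by (auto simp: embeds_via_def bij_betw_def)
  then show ?thesis
    by blast
qed

lemma configuration_in_if_embeds_via:
  assumes "embeds_via f g F A"
  shows "F \<prec>\<^sub>c A"
proof -
  let ?I = "f ` {..<dim_row F}" and ?J = "g ` {..<dim_col F}"
  have f: "inj_on f {..<dim_row F}" "?I \<subseteq> {..<dim_row A}"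
    and g: "inj_on g {..<dim_col F}" "?J \<subseteq> {..<dim_col A}"
    using assms by (auto simp: embeds_via_def)
  obtain p where p: "p permutes {..<dim_row F}" "\<And>i. i < dim_row F \<Longrightarrow> f (p i) = pick ?I i"
    using f(1) by (rule ex_permutes_pick_image) blast
  obtain q where q: "q permutes {..<dim_col F}" "\<And>j. j < dim_col F \<Longrightarrow> g (q j) = pick ?J j"
    using g(1) by (rule ex_permutes_pick_image) blast
  have "{i. i < dim_row A \<and> i \<in> ?I} = ?I" "{j. j < dim_col A \<and> j \<in> ?J} = ?J"
    using f(2) g(2) by blast+
  then have dims: "card {i. i < dim_row A \<and> i \<in> ?I} = dim_row F"
    "card {j. j < dim_col A \<and> j \<in> ?J} = dim_col F"
    using f(1) g(1) by (simp_all only: card_image card_lessThan)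
  have "permute_mat p q F = submatrix A ?I ?J"
  proof (rule eq_matI)
    fix i j assume "i < dim_row (submatrix A ?I ?J)" "j < dim_col (submatrix A ?I ?J)"
    then have bounds: "i < dim_row F" "j < dim_col F"
      by (simp_all only: dim_submatrix dims)
    have "p i < dim_row F" "q j < dim_col F"
      using bounds permutes_in_image[OF p(1)] permutes_in_image[OF q(1)] by (metis lessThan_iff)+
    then have "permute_mat p q F $$ (i, j) = A $$ (f (p i), g (q j))"
      using assms bounds by (simp add: permute_mat_def embeds_via_def)
    then show "permute_mat p q F $$ (i, j) = submatrix A ?I ?J $$ (i, j)"
      using bounds p(2) q(2) dims by (simp add: submatrix_index)
  qed (simp_all only: permute_mat_def dim_row_mat dim_col_mat dim_submatrix dims)
  then show ?thesis
    unfolding configuration_in_def using p(1) q(1) by blast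
qed

lemma configuration_in_iff_embeds_via: "F \<prec>\<^sub>c A \<longleftrightarrow> (\<exists>f g. embeds_via f g F A)"
  using embeds_via_if_configuration_in configuration_in_if_embeds_via by blast

subsection \<open>Column supports\<close>

definition col_support :: "nat mat \<Rightarrow> nat \<Rightarrow> nat set" where
  "col_support A j = {i. i < dim_row A \<and> A $$ (i, j) = 1}"

definition supports :: "nat mat \<Rightarrow> nat set set" where
  "supports A = col_support A ` {..<dim_col A}"

lemma supports_subset_Pow: "supports A \<subseteq> Pow {..<dim_row A}"
  by (auto simp: supports_def col_support_def)

lemma zero_one_mat_iff:
  "zero_one_mat A \<longleftrightarrow> (\<forall>i<dim_row A. \<forall>j<dim_col A. A $$ (i, j) = 0 \<or> A $$ (i, j) = 1)"
proof -
  have "elements_mat A = {A $$ (i, j) |i j. i < dim_row A \<and> j < dim_col A}"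
    unfolding elements_mat_def by fastforce
  then show ?thesis
    unfolding zero_one_mat_def by (auto simp: subset_iff)
qed

lemma index_eq_col_support:
  assumes "zero_one_mat A" "i < dim_row A" "j < dim_col A"
  shows "A $$ (i, j) = (if i \<in> col_support A j then 1 else 0)"
  using assms by (auto simp: zero_one_mat_iff col_support_def)

lemma simple_mat_iff_inj_on_col_support:
  "simple_mat A \<longleftrightarrow> zero_one_mat A \<and> inj_on (col_support A) {..<dim_col A}"
proof -
  have "distinct (cols A) \<longleftrightarrow> inj_on (col_support A) {..<dim_col A}" if "zero_one_mat A"
  proof -
    have "col A j = col A k \<longleftrightarrow> col_support A j = col_support A k"
      if "j < dim_col A" "k < dim_col A" for j k
    proof
      assume "col A j = col A k"
      then have "A $$ (i, j) = A $$ (i, k)" if "i < dim_row A" for i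
        using that \<open>j < dim_col A\<close> \<open>k < dim_col A\<close> by (metis index_col)
      then show "col_support A j = col_support A k"
        by (auto simp: col_support_def)
    next
      assume "col_support A j = col_support A k"
      then show "col A j = col A k"
        using that \<open>zero_one_mat A\<close> by (intro eq_vecI) (simp_all add: index_eq_col_support)
    qed
    then show ?thesis
      by (auto simp: cols_def distinct_map inj_on_def)
  qed
  then show ?thesis
    by (auto simp: simple_mat_def)
qed

lemma card_supports: "simple_mat A \<Longrightarrow> card (supports A) = dim_col A"
  by (simp add: supports_def card_image simple_mat_iff_inj_on_col_support)

lemma ex_simple_mat_supports:
  assumes "\<A> \<subseteq> Pow {..<m}"
  obtains A where "dim_row A = m" "simple_mat A" "supports A = \<A>"
proof -
  have "finite \<A>"
    using assms by (meson finite_Pow_iff finite_lessThan finite_subset)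
  then obtain Bs where Bs: "set Bs = \<A>" "distinct Bs"
    using finite_distinct_list by blast
  define A :: "nat mat" where "A = mat m (length Bs) (\<lambda>(i, j). if i \<in> Bs ! j then 1 else 0)"
  have col_support: "col_support A j = Bs ! j" if "j < length Bs" for j
  proof -
    have "Bs ! j \<subseteq> {..<m}"
      using that Bs(1) assms nth_mem by blast
    then show ?thesis
      using that by (auto simp: A_def col_support_def split: if_splits)
  qed
  show thesis
  proof
    show "dim_row A = m"
      by (simp add: A_def)
    show "simple_mat A"
      using col_support Bs(2) unfolding simple_mat_iff_inj_on_col_support zero_one_mat_iff
      by (auto simp: A_def inj_on_def nth_eq_iff_index_eq)
    show "supports A = \<A>"
      using col_support Bs(1) by (auto simp: supports_def A_def set_conv_nth)
  qed
qed

definition ones_zeros_mat :: "nat \<Rightarrow> nat \<Rightarrow> nat \<Rightarrow> nat mat" where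
  "ones_zeros_mat a d s = mat (a + d) s (\<lambda>(i, j). if i < a then 1 else 0)"

lemma dim_ones_zeros_mat [simp]:
  "dim_row (ones_zeros_mat a d s) = a + d" "dim_col (ones_zeros_mat a d s) = s"
  by (simp_all add: ones_zeros_mat_def)

lemma copies_F_mat_eq_ones_zeros_mat:
  "copies_mat t (F_mat a 0 0 d) = ones_zeros_mat a d (2 * t)"
proof (rule eq_matI)
  let ?F = "F_mat a 0 0 d"
  let ?cs = "concat (replicate t (cols ?F))"
  have dim: "dim_row ?F = a + d" "dim_col ?F = 2"
    by (simp_all add: F_mat_def mat_of_rows_list_def)
  have len: "length ?cs = 2 * t"
    by (simp add: dim length_concat sum_list_replicate)
  show "dim_row (copies_mat t ?F) = dim_row (ones_zeros_mat a d (2 * t))"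
    "dim_col (copies_mat t ?F) = dim_col (ones_zeros_mat a d (2 * t))"
    by (simp_all add: copies_mat_def dim len)
  fix i j assume "i < dim_row (ones_zeros_mat a d (2 * t))" "j < dim_col (ones_zeros_mat a d (2 * t))"
  then have bounds: "i < a + d" "j < 2 * t"
    by simp_all
  have "?cs ! j \<in> set (cols ?F)"
    using nth_mem[of j ?cs] len bounds(2) by auto
  then obtain k where k: "k < 2" "?cs ! j = col ?F k"
    by (auto simp: cols_def dim)
  have "copies_mat t ?F $$ (i, j) = ?F $$ (i, k)"
    using bounds len k by (simp add: copies_mat_def mat_of_cols_index dim)
  also have "\<dots> = ones_zeros_mat a d (2 * t) $$ (i, j)"
    using bounds k(1)
    by (auto simp: F_mat_def mat_of_rows_list_def ones_zeros_mat_def nth_append less_2_cases_iff)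
  finally show "copies_mat t ?F $$ (i, j) = ones_zeros_mat a d (2 * t) $$ (i, j)" .
qed

lemma has_pattern_if_embeds_via_ones_zeros_mat:
  assumes "simple_mat A" "embeds_via f g (ones_zeros_mat a d s) A"
  shows "has_pattern {..<dim_row A} s a d (supports A)"
proof -
  let ?R = "f ` {..<a}" and ?S = "f ` {a..<a + d}"
  have f: "inj_on f {..<a + d}" "f ` {..<a + d} \<subseteq> {..<dim_row A}"
    and g: "inj_on g {..<s}" "g ` {..<s} \<subseteq> {..<dim_col A}"
    using assms(2) by (simp_all add: embeds_via_def)
  have entry: "A $$ (f i, g j) = (if i < a then 1 else 0)" if "i < a + d" "j < s" for i j
    using assms(2) that by (auto simp: embeds_via_def ones_zeros_mat_def)
  have rows: "f i < dim_row A" if "i < a + d" for i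
    using f(2) that by (simp add: image_subset_iff)
  show ?thesis
  proof (rule has_patternI[of ?R _ ?S])
    show "?R \<subseteq> {..<dim_row A}" "?S \<subseteq> {..<dim_row A}"
      using rows by auto
    have "?R \<inter> ?S = f ` ({..<a} \<inter> {a..<a + d})"
      by (rule inj_on_image_Int[OF f(1), symmetric]) auto
    then show "?R \<inter> ?S = {}"
      by auto
    have "inj_on f {..<a}" "inj_on f {a..<a + d}"
      by (rule inj_on_subset[OF f(1)]; auto)+
    then show "card ?R = a" "card ?S = d"
      by (simp_all add: card_image)
    have "inj_on (col_support A) (g ` {..<s})"
      using assms(1) g(2) by (auto simp: simple_mat_iff_inj_on_col_support intro: inj_on_subset)
    then have "s = card (col_support A ` g ` {..<s})"
      using g(1) by (simp add: card_image)
    also have "\<dots> \<le> card (cylinder ?R ?S (supports A))"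
    proof (rule card_mono)
      show "col_support A ` g ` {..<s} \<subseteq> cylinder ?R ?S (supports A)"
        using rows g(2) entry by (auto simp: cylinder_def supports_def col_support_def)
    qed (simp add: finite_cylinder supports_def)
    finally show "s \<le> card (cylinder ?R ?S (supports A))" .
  qed
qed

lemma ex_bij_betw_disjoint_Un:
  assumes "finite R" "finite S" "R \<inter> S = {}"
  obtains f :: "nat \<Rightarrow> 'a" where "bij_betw f {..<card R + card S} (R \<union> S)"
    "f ` {..<card R} = R" "f ` {card R..<card R + card S} = S"
proof -
  let ?I = "{..<card R}" and ?J = "{card R..<card R + card S}"
  obtain r z where r: "bij_betw r ?I R" and z: "bij_betw z ?J S"
    using assms(1,2) finite_same_card_bij[of ?I R] finite_same_card_bij[of ?J S] by auto
  define f where "f i = (if i \<in> ?I then r i else z i)" for i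
  have "bij_betw f (?I \<union> ?J) (R \<union> S)"
    unfolding f_def using r z assms(3) by (intro bij_betw_disjoint_Un) auto
  moreover have "f ` ?I = R" "f ` ?J = S"
    using r z by (simp_all add: f_def bij_betw_def)
  ultimately show thesis
    using that by (simp add: ivl_disj_un)
qed

lemma embeds_via_ones_zeros_mat_if_has_pattern:
  assumes "simple_mat A" "has_pattern {..<dim_row A} s a d (supports A)"
  shows "\<exists>f g. embeds_via f g (ones_zeros_mat a d s) A"
proof -
  obtain R S where RS: "R \<subseteq> {..<dim_row A}" "S \<subseteq> {..<dim_row A}" "R \<inter> S = {}"
    "card R = a" "card S = d" and large: "s \<le> card (cylinder R S (supports A))"
    using assms(2) by (rule has_patternE)
  have "finite R" "finite S"
    using RS(1,2) by (auto intro: finite_subset)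
  then obtain f where f: "bij_betw f {..<a + d} (R \<union> S)" "f ` {..<a} = R" "f ` {a..<a + d} = S"
    using ex_bij_betw_disjoint_Un[OF _ _ RS(3)] RS(4,5) by metis
  have f_mem: "if i < a then f i \<in> R else f i \<in> S" if "i < a + d" for i
    using that f(2,3) by auto
  define J where "J = {j. j < dim_col A \<and> col_support A j \<in> cylinder R S (supports A)}"
  have "cylinder R S (supports A) \<subseteq> col_support A ` J"
    by (auto simp: J_def cylinder_def supports_def)
  then have "card (cylinder R S (supports A)) \<le> card J"
    by (intro surj_card_le) (simp add: J_def)
  then obtain g where g: "g ` {..<s} \<subseteq> J" "inj_on g {..<s}"
    using card_le_inj[of "{..<s}" J] large by (auto simp: J_def)
  have "A $$ (f i, g j) = (if i < a then 1 else 0)" if "i < a + d" "j < s" for i j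
  proof -
    have "f i < dim_row A" "g j < dim_col A" "R \<subseteq> col_support A (g j)"
      "S \<inter> col_support A (g j) = {}"
      using that f_mem[of i] g(1) RS(1,2) by (auto simp: J_def cylinder_def split: if_splits)
    moreover have "zero_one_mat A"
      using assms(1) by (simp add: simple_mat_def)
    ultimately show ?thesis
      using f_mem[OF that(1)] by (auto simp: index_eq_col_support split: if_splits)
  qed
  then have "embeds_via f g (ones_zeros_mat a d s) A"
    using f(1) g RS(1,2) by (auto simp: embeds_via_def ones_zeros_mat_def J_def bij_betw_def)
  then show ?thesis
    by blast
qed

lemma configuration_in_ones_zeros_mat_iff:
  assumes "simple_mat A"
  shows "ones_zeros_mat a d s \<prec>\<^sub>c A \<longleftrightarrow> has_pattern {..<dim_row A} s a d (supports A)"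
  using assms has_pattern_if_embeds_via_ones_zeros_mat embeds_via_ones_zeros_mat_if_has_pattern
  unfolding configuration_in_iff_embeds_via by blast

subsection \<open>The extremal function\<close>

lemma dim_col_le_forb: "A \<in> avoiding m F \<Longrightarrow> dim_col A \<le> forb m F"
  unfolding forb_def using finite_dim_col_avoiding by (intro Max_ge) auto

lemma forb_leI:
  assumes "dim_col F > 0" "\<And>A. A \<in> avoiding m F \<Longrightarrow> dim_col A \<le> n"
  shows "forb m F \<le> n"
  unfolding forb_def using finite_dim_col_avoiding avoiding_nonempty[OF assms(1)] assms(2)
  by (subst Max_le_iff) auto

lemma forb_ones_zeros_mat_le:
  assumes "s \<ge> 1"
  shows "forb m (ones_zeros_mat a d s) \<le> 2 ^ min a d * s * (m + 1) ^ max a d"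
proof (rule forb_leI)
  fix A assume A: "A \<in> avoiding m (ones_zeros_mat a d s)"
  then have "dim_row A = m" "simple_mat A"
    by (simp_all add: avoiding_def)
  then have "\<not> has_pattern {..<m} s a d (supports A)"
    using A configuration_in_ones_zeros_mat_iff by (auto simp: avoiding_def)
  moreover have "x = a \<and> y = d" if "x \<le> a" "y \<le> d" "x + y = min a d + max a d" for x y
    using that by linarith
  ultimately have "pattern_free {..<m} s a d (min a d + max a d) (supports A)"
    unfolding pattern_free_def by blast
  then have "card (supports A) \<le> 2 ^ min a d * s * (card {..<m} + 1) ^ max a d"
    using supports_subset_Pow[of A] \<open>dim_row A = m\<close> assms
    by (intro card_le_if_pattern_free[of _ _ _ _ a d]) auto
  then show "dim_col A \<le> 2 ^ min a d * s * (m + 1) ^ max a d"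
    using \<open>simple_mat A\<close> by (simp add: card_supports)
qed (use assms in simp)

lemma binomial_le_forb_ones_zeros_mat:
  assumes "s \<ge> 2"
  shows "m choose a \<le> forb m (ones_zeros_mat a d s)"
proof -
  let ?\<A> = "{B. B \<subseteq> {..<m} \<and> card B = a}"
  obtain A where A: "dim_row A = m" "simple_mat A" "supports A = ?\<A>"
    by (rule ex_simple_mat_supports[of ?\<A> m]) auto
  then have "A \<in> avoiding m (ones_zeros_mat a d s)"
    using assms by (simp add: avoiding_def configuration_in_ones_zeros_mat_iff not_has_pattern_uniform)
  then have "dim_col A \<le> forb m (ones_zeros_mat a d s)"
    by (rule dim_col_le_forb)
  moreover have "dim_col A = m choose a"
    using card_supports[OF A(2)] A(3) n_subsets[of "{..<m}" a] by simp
  ultimately show ?thesis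
    by simp
qed

lemma power_in_bigo_binomial: "(\<lambda>n. real n ^ k) \<in> O(\<lambda>n. real (n choose k))"
proof (rule bigoI)
  show "\<forall>\<^sub>F n in at_top. norm (real n ^ k) \<le> real k ^ k * norm (real (n choose k))"
    using eventually_ge_at_top[of k]
  proof eventually_elim
    case (elim n)
    have "real n ^ k = real k ^ k * (real n / real k) ^ k"
      by (cases "k = 0") (simp_all add: power_divide)
    also have "\<dots> \<le> real k ^ k * real (n choose k)"
      by (intro mult_left_mono binomial_ge_n_over_k_pow_k[OF elim]) simp
    finally show ?case
      by simp
  qed
qed

lemma forb_ones_zeros_mat_bigtheta:
  assumes "s \<ge> 2" "d \<le> a"
  shows "(\<lambda>m. real (forb m (ones_zeros_mat a d s))) \<in> \<Theta>(\<lambda>m. real m ^ a)"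
proof (rule bigthetaI)
  let ?f = "\<lambda>m. forb m (ones_zeros_mat a d s)"
  have upper: "?f m \<le> 2 ^ d * s * (m + 1) ^ a" for m
    using forb_ones_zeros_mat_le[of s m a d] assms by (simp add: min_absorb2 max_absorb1)
  have "(\<lambda>m. real (?f m)) \<in> O(\<lambda>m. real (2 ^ d * s * (m + 1) ^ a))"
    by (intro landau_o.big_mono always_eventually) (use upper in \<open>simp del: of_nat_mult\<close>)
  also have "(\<lambda>m. real (2 ^ d * s * (m + 1) ^ a)) \<in> O(\<lambda>m. real m ^ a)"
    by real_asymp
  finally show "(\<lambda>m. real (?f m)) \<in> O(\<lambda>m. real m ^ a)" .
  have "(\<lambda>m. real m ^ a) \<in> O(\<lambda>m. real (m choose a))"
    by (rule power_in_bigo_binomial)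
  also have "(\<lambda>m. real (m choose a)) \<in> O(\<lambda>m. real (?f m))"
    by (intro landau_o.big_mono always_eventually)
      (simp add: binomial_le_forb_ones_zeros_mat[OF assms(1)])
  finally show "(\<lambda>m. real (?f m)) \<in> \<Omega>(\<lambda>m. real m ^ a)"
    by (simp add: bigomega_iff_bigo)
qed

theorem theorem4:
  fixes t a d :: nat
  assumes "t \<ge> 2" and "a \<ge> d" and "a \<ge> 1"
  shows "(\<lambda>m. real (forb m (copies_mat t (F_mat a 0 0 d)))) \<in> \<Theta>(\<lambda>m. real m ^ a)"
proof -
  have "(\<lambda>m. real (forb m (ones_zeros_mat a d (2 * t)))) \<in> \<Theta>(\<lambda>m. real m ^ a)"
    using assms(1,2) by (intro forb_ones_zeros_mat_bigtheta) simp_all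
  then show ?thesis
    by (simp only: copies_F_mat_eq_ones_zeros_mat)
qed

end
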